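(* For each $n\ge1$, Han's map $H\colon S_n\to S_n$ satisfies $H=I^{-1}\circ M$; that is, $H$ is a bijection on $S_n$ with $M(\sigma)=I(H(\sigma))$ for every $\sigma\in S_n$.
   Context: $S_n$ is the set of permutations of $[n]$ in one-line notation. Let $E_n=\{(a_1,\ldots,a_n)\in\mathbb Z^n: 0\le a_i\le i-1\}$. Cyclic intervals: for $x,y\in[n]$, $\rrbracket x,y\rrbracket=\{z\in[n]:x<z\le y\}$ if $x\le y$, and $\{z\in[n]: z>x\text{ or }z\le y\}$ if $x>y$; $\rrbracket x,\infty\rrbracket=\{z\in[n]:z>x\}$. For $\sigma\in S_n$ let $t_i(\sigma)=\#\{j<i:\sigma_j\in\rrbracket\sigma_i,\infty\rrbracket\}$ and $s_i(\sigma)=\#\{j<i:\sigma_j\in\rrbracket\sigma_i,\sigma_{i+1}\rrbracket\}$ (with $\sigma_{n+1}=\infty$). The inversion code $I(\sigma)=(t_1(\sigma),\ldots,t_n(\sigma))$ and the cyclic major code $M(\sigma)=(s_1(\sigma),\ldots,s_n(\sigma))$ are both bijections $S_n\to E_n$. For $x\in[n]$ and a permutation $\sigma=\sigma_1\cdots\sigma_{n-1}$ of $[n]\setminus\{x\}$, define $C^x(\sigma)=\tau_1\cdots\tau_{n-1}\in S_{n-1}$ with $\tau_i=\sigma_i-x+n$ if $\sigma_i<x$ and $\tau_i=\sigma_i-x$ if $\sigma_i>x$; and define the standardization $C_x(\sigma)=\nu_1\cdots\nu_{n-1}\in S_{n-1}$ with $\nu_i=\sigma_i$ if $\sigma_i<x$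 and $\nu_i=\sigma_i-1$ if $\sigma_i>x$. Both are bijections from permutations of $[n]\setminus\{x\}$ onto $S_{n-1}$. Han's map $H$ is defined recursively by $H(1)=1$ and, for $\sigma\in S_n$ with $n>1$ and $\sigma'=\sigma_1\cdots\sigma_{n-1}$, $H(\sigma)=C_{\sigma_n}^{-1}\big(H(C^{\sigma_n}(\sigma'))\big)\cdot\sigma_n$ (concatenation). *)

theory Defs
  imports "HOL-Combinatorics.Multiset_Permutations" "HOL-Library.Extended_Nat"
begin

(* Permutations in one-line notation are lists; the set S_n of permutations of [n] is
   "perms n".  Mathematical indices start at 1, list positions at 0. *)
abbreviation perms :: "nat \<Rightarrow> nat list set" where
  "perms n \<equiv> permutations_of_set {1..n}"

definition entry :: "nat list \<Rightarrow> nat \<Rightarrow> nat" where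
  "entry \<sigma> i = \<sigma> ! (i - 1)"

(* The one-line notation extended by the convention that the entry after the last one
   is infinity. *)
definition entry_inf :: "nat list \<Rightarrow> nat \<Rightarrow> enat" where
  "entry_inf \<sigma> i = (if i \<le> length \<sigma> then enat (entry \<sigma> i) else \<infinity>)"

(* The half-open cyclic interval ]]x, y]] in [n].  The right end point may be infinity, and
   then the first branch yields all z in [n] with z > x. *)
definition cyc_interval :: "nat \<Rightarrow> nat \<Rightarrow> enat \<Rightarrow> nat set" where
  "cyc_interval n x y =
     (if enat x \<le> y then {z \<in> {1..n}. x < z \<and> enat z \<le> y}
      else {z \<in> {1..n}. x < z \<or> enat z \<le> y})"

definition t_stat :: "nat list \<Rightarrow> nat \<Rightarrow> nat" where
  "t_stat \<sigma> i = card {j \<in> {1..<i}. entry \<sigma> j \<in> cyc_interval (length \<sigma>) (entry \<sigma> i) \<infinity>}"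

definition s_stat :: "nat list \<Rightarrow> nat \<Rightarrow> nat" where
  "s_stat \<sigma> i = card {j \<in> {1..<i}. entry \<sigma> j \<in>
     cyc_interval (length \<sigma>) (entry \<sigma> i) (entry_inf \<sigma> (i + 1))}"

definition inv_code :: "nat list \<Rightarrow> nat list" where
  "inv_code \<sigma> = map (t_stat \<sigma>) [1..<length \<sigma> + 1]"

definition maj_code :: "nat list \<Rightarrow> nat list" where
  "maj_code \<sigma> = map (s_stat \<sigma>) [1..<length \<sigma> + 1]"

(* C^x on permutations of [n] - {x}.  The branch s - x + n is written s + n - x because
   subtraction on nat truncates. *)
definition cyc_shift :: "nat \<Rightarrow> nat \<Rightarrow> nat list \<Rightarrow> nat list" where
  "cyc_shift n x \<sigma> = map (\<lambda>s. if s < x then s + n - x else s - x) \<sigma>"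

(* C_x *)
definition standardize :: "nat \<Rightarrow> nat list \<Rightarrow> nat list" where
  "standardize x \<sigma> = map (\<lambda>s. if s < x then s else s - 1) \<sigma>"

(* The inverse of C_x as a map from the permutations of [n] - {x} onto S_(n-1). *)
definition standardize_inv :: "nat \<Rightarrow> nat \<Rightarrow> nat list \<Rightarrow> nat list" where
  "standardize_inv n x = inv_into (permutations_of_set ({1..n} - {x})) (standardize x)"

(* On S_1 the map is the identity; the value on the empty list is irrelevant. *)
function han :: "nat list \<Rightarrow> nat list" where
  "han \<sigma> =
     (if length \<sigma> \<le> 1 then \<sigma>
      else standardize_inv (length \<sigma>) (last \<sigma>)
             (han (cyc_shift (length \<sigma>) (last \<sigma>) (butlast \<sigma>))) @ [last \<sigma>])"
  by auto
termination
  by (relation "measure length") (auto simp: cyc_shift_def)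

declare han.simps [simp del]

end

theory Submission
  imports Defs
begin

text \<open>
  Both codes satisfy a recursion that removes the last letter \<open>x\<close>: in either case the last entry
  of the code is \<open>n - x\<close>, while the other entries form the inversion code of \<open>C\<^sub>x(\<sigma>')\<close>,
  respectively the cyclic major code of \<open>C\<^sup>x(\<sigma>')\<close>. The latter holds because \<open>C\<^sup>x\<close> rotates \<open>[n]\<close>
  so that \<open>x\<close> becomes the largest letter: cyclic intervals are preserved, and one that ends at \<open>x\<close>
  becomes one that ends at infinity. Han's map is designed to intertwine the two recursions.
\<close>

section \<open>Bijectivity of the two reductions and splitting off the last letter\<close>

text \<open>Both reductions act letter by letter, so this leaves only maps on single letters to be
  checked.\<close>

lemma bij_betw_map_permutations_of_set:
  assumes "bij_betw f A B"
  shows "bij_betw (map f) (permutations_of_set A) (permutations_of_set B)"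
proof -
  have inj: "inj_on f A" and B: "B = f ` A"
    using assms by (auto simp: bij_betw_def)
  have "inj_on (map f) (lists A)"
    using inj by (intro inj_on_mapI) (auto intro: inj_on_subset)
  hence "inj_on (map f) (permutations_of_set A)"
    by (rule inj_on_subset) (auto simp: permutations_of_set_def)
  thus ?thesis
    using inj by (simp add: bij_betw_def B permutations_of_set_image_inj)
qed

lemma bij_betw_standardize:
  assumes "x \<in> {1..Suc n}"
  shows "bij_betw (standardize x) (permutations_of_set ({1..Suc n} - {x})) (perms n)"
proof -
  have "bij_betw (\<lambda>s. if s < x then s else s - 1) ({1..Suc n} - {x}) {1..n}"
    using assms
    by (intro bij_betw_byWitness[where f' = "\<lambda>s. if s < x then s else Suc s"]) auto
  thus ?thesis
    unfolding standardize_def[abs_def] by (rule bij_betw_map_permutations_of_set)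
qed

text \<open>The map is subtraction of \<open>x\<close> modulo \<open>Suc n\<close>, with
  \<open>x\<close> the only letter of residue 0. The inverse adds \<open>x\<close> modulo
  \<open>Suc n\<close>, with representatives in \<open>{1..Suc n}\<close>.\<close>

lemma bij_betw_rotate:
  assumes "x \<in> {1..Suc n}"
  shows "bij_betw (\<lambda>s. if s < x then s + Suc n - x else s - x) ({1..Suc n} - {x}) {1..n}"
    (is "bij_betw ?f _ _")
proof (rule bij_betw_byWitness[where f' = "\<lambda>s. if s + x \<le> Suc n then s + x else s + x - Suc n"])
  show "?f ` ({1..Suc n} - {x}) \<subseteq> {1..n}"
  proof (rule image_subsetI)
    fix s assume "s \<in> {1..Suc n} - {x}"
    thus "?f s \<in> {1..n}" using assms by (cases "s < x") auto
  qed
next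
  show "\<forall>s \<in> {1..Suc n} - {x}.
    (if ?f s + x \<le> Suc n then ?f s + x else ?f s + x - Suc n) = s"
  proof
    fix s assume "s \<in> {1..Suc n} - {x}"
    thus "(if ?f s + x \<le> Suc n then ?f s + x else ?f s + x - Suc n) = s"
      using assms by (cases "s < x") auto
  qed
next
  show "\<forall>s \<in> {1..n}. ?f (if s + x \<le> Suc n then s + x else s + x - Suc n) = s"
  proof
    fix s assume "s \<in> {1..n}"
    thus "?f (if s + x \<le> Suc n then s + x else s + x - Suc n) = s"
      using assms by (cases "s + x \<le> Suc n") auto
  qed
next
  show "(\<lambda>s. if s + x \<le> Suc n then s + x else s + x - Suc n) ` {1..n} \<subseteq> {1..Suc n} - {x}"
  proof (rule image_subsetI)
    fix s assume "s \<in> {1..n}"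
    thus "(if s + x \<le> Suc n then s + x else s + x - Suc n) \<in> {1..Suc n} - {x}"
      using assms by (cases "s + x \<le> Suc n") auto
  qed
qed

lemma bij_betw_cyc_shift:
  assumes "x \<in> {1..Suc n}"
  shows "bij_betw (cyc_shift (Suc n) x) (permutations_of_set ({1..Suc n} - {x})) (perms n)"
  unfolding cyc_shift_def[abs_def]
  using bij_betw_map_permutations_of_set[OF bij_betw_rotate[OF assms]] .

text \<open>This is the case distinction behind every induction on \<open>n\<close> below.\<close>

lemma perms_Suc_iff:
  "\<sigma> \<in> perms (Suc n) \<longleftrightarrow>
     (\<exists>x \<in> {1..Suc n}. \<exists>\<rho> \<in> permutations_of_set ({1..Suc n} - {x}). \<sigma> = \<rho> @ [x])"
proof
  assume \<sigma>: "\<sigma> \<in> perms (Suc n)"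
  hence "set \<sigma> = {1..Suc n}" "distinct \<sigma>"
    by (auto dest: permutations_of_setD)
  moreover from this have "\<sigma> \<noteq> []" by auto
  then obtain \<rho> x where "\<sigma> = \<rho> @ [x]"
    by (metis append_butlast_last_id)
  ultimately show "\<exists>x \<in> {1..Suc n}. \<exists>\<rho> \<in> permutations_of_set ({1..Suc n} - {x}). \<sigma> = \<rho> @ [x]"
    by (intro bexI[of _ x] bexI[of _ \<rho>]) (auto simp: permutations_of_set_def)
next
  assume "\<exists>x \<in> {1..Suc n}. \<exists>\<rho> \<in> permutations_of_set ({1..Suc n} - {x}). \<sigma> = \<rho> @ [x]"
  then obtain x \<rho> where x: "x \<in> {1..Suc n}" and \<sigma>: "\<sigma> = \<rho> @ [x]"
    and \<rho>: "set \<rho> = {1..Suc n} - {x}" "distinct \<rho>"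
    by (metis permutations_of_setD)
  have "set \<sigma> = {1..Suc n}"
    unfolding \<sigma> set_append \<rho>(1) using x by auto
  thus "\<sigma> \<in> perms (Suc n)"
    using \<rho> by (intro permutations_of_setI) (simp_all add: \<sigma>)
qed

lemma length_permutations_of_interval_remove:
  assumes "\<rho> \<in> permutations_of_set ({1..Suc n} - {x})" "x \<in> {1..Suc n}"
  shows "length \<rho> = n"
  using assms length_finite_permutations_of_set[of \<rho> "{1..Suc n} - {x}"] by simp

section \<open>Cyclic intervals under rotation and standardization\<close>

text \<open>Rotation lists the letters above \<open>x\<close> first and those below \<open>x\<close>
  after them, keeping the order inside each block.\<close>

lemma rotate_le_iff:
  fixes x n s t :: nat
  assumes "s \<le> Suc n" "t \<le> Suc n" "x \<le> Suc n" "s \<noteq> x" "t \<noteq> x" "1 \<le> s" "1 \<le> t"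
  defines "f \<equiv> \<lambda>s. if s < x then s + Suc n - x else s - x"
  shows "f s \<le> f t \<longleftrightarrow> (if s < x then t < x \<and> s \<le> t else t < x \<or> s \<le> t)"
  using assms(1-7) unfolding f_def
  by (cases "s < x"; cases "t < x"; simp add: le_diff_iff; arith?)

text \<open>Membership in a cyclic interval depends only on the cyclic order, which rotation
  preserves. Once comparisons of rotated letters are translated back, a case split on the sides of
  \<open>x\<close> settles it.\<close>

lemma mem_cyc_interval_rotate:
  assumes "x \<in> {1..Suc n}" "{a, b, z} \<subseteq> {1..Suc n} - {x}"
  defines "f \<equiv> \<lambda>s. if s < x then s + Suc n - x else s - x"
  shows "f z \<in> cyc_interval n (f a) (enat (f b)) \<longleftrightarrow> z \<in> cyc_interval (Suc n) a (enat b)"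
proof -
  have "f z \<in> {1..n}"
    unfolding f_def using bij_betwE[OF bij_betw_rotate] assms(1,2) by blast
  moreover have "f a \<le> f b \<longleftrightarrow> (if a < x then b < x \<and> a \<le> b else b < x \<or> a \<le> b)"
    and "f z \<le> f b \<longleftrightarrow> (if z < x then b < x \<and> z \<le> b else b < x \<or> z \<le> b)"
    and "f z \<le> f a \<longleftrightarrow> (if z < x then a < x \<and> z \<le> a else a < x \<or> z \<le> a)"
    unfolding f_def using assms(1,2) by (intro rotate_le_iff; simp)+
  moreover have "f a < f z \<longleftrightarrow> \<not> f z \<le> f a"
    by auto
  moreover have "z \<in> {1..Suc n}"
    using assms(2) by simp
  ultimately show ?thesis
    unfolding cyc_interval_def mem_Collect_eq enat_ord_simps if_distrib[of "(\<in>) _"]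
    by (cases "a < x"; cases "b < x"; cases "z < x"; cases "a \<le> b";
        simp del: One_nat_def; linarith?)
qed

text \<open>Modulo \<open>Suc n\<close> the letter \<open>x\<close> goes to 0; represented by
  \<open>Suc n\<close>, it lies above all rotated letters, just as infinity does.\<close>

lemma mem_cyc_interval_rotate_infinity:
  assumes "x \<in> {1..Suc n}" "{a, z} \<subseteq> {1..Suc n} - {x}"
  defines "f \<equiv> \<lambda>s. if s < x then s + Suc n - x else s - x"
  shows "f z \<in> cyc_interval n (f a) \<infinity> \<longleftrightarrow> z \<in> cyc_interval (Suc n) a (enat x)"
proof -
  have "f z \<in> {1..n}"
    unfolding f_def using bij_betwE[OF bij_betw_rotate] assms(1,2) by blast
  moreover have "f z \<le> f a \<longleftrightarrow> (if z < x then a < x \<and> z \<le> a else a < x \<or> z \<le> a)"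
    unfolding f_def using assms(1,2) by (intro rotate_le_iff; simp)
  moreover have "f a < f z \<longleftrightarrow> \<not> f z \<le> f a"
    by auto
  ultimately show ?thesis
    using assms(2) unfolding cyc_interval_def by auto
qed

text \<open>Closing the gap at \<open>x\<close> preserves the order, and an interval ending at
  infinity asks only which letters are larger.\<close>

lemma mem_cyc_interval_standardize:
  assumes "x \<in> {1..Suc n}" "{a, z} \<subseteq> {1..Suc n} - {x}"
  defines "f \<equiv> \<lambda>s. if s < x then s else s - 1"
  shows "f z \<in> cyc_interval n (f a) \<infinity> \<longleftrightarrow> z \<in> cyc_interval (Suc n) a \<infinity>"
  using assms(1,2) unfolding f_def cyc_interval_def
  by (cases "a < x"; cases "z < x"; simp; linarith?)

section \<open>Recursions for the two codes\<close>

lemma entry_append1: "i \<in> {1..length \<rho>} \<Longrightarrow> entry (\<rho> @ xs) i = entry \<rho> i"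
  by (auto simp: entry_def nth_append)

lemma entry_snoc_last: "entry (\<rho> @ [x]) (Suc (length \<rho>)) = x"
  by (simp add: entry_def)

lemma entry_map: "i \<in> {1..length \<rho>} \<Longrightarrow> entry (map f \<rho>) i = f (entry \<rho> i)"
  by (auto simp: entry_def)

lemma entry_mem_set: "i \<in> {1..length \<rho>} \<Longrightarrow> entry \<rho> i \<in> set \<rho>"
  by (auto simp: entry_def)

text \<open>All other letters precede the last one, so the count is that of the letters exceeding
  \<open>x\<close>.\<close>

lemma t_stat_snoc_last:
  assumes "\<rho> \<in> permutations_of_set ({1..Suc n} - {x})" "x \<in> {1..Suc n}"
  shows "t_stat (\<rho> @ [x]) (Suc n) = Suc n - x"
proof -
  have len: "length \<rho> = n" and set: "set \<rho> = {1..Suc n} - {x}" and dist: "distinct \<rho>"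
    using assms length_permutations_of_interval_remove by (auto dest: permutations_of_setD)
  let ?J = "{j \<in> {1..<Suc n}. x < entry \<rho> j}"
  have "t_stat (\<rho> @ [x]) (Suc n) = card ?J"
    unfolding t_stat_def
  proof (intro arg_cong[where f = card] Collect_cong conj_cong refl)
    fix j assume "j \<in> {1..<Suc n}"
    hence "j \<in> {1..length \<rho>}" using len by auto
    thus "entry (\<rho> @ [x]) j \<in> cyc_interval (length (\<rho> @ [x])) (entry (\<rho> @ [x]) (Suc n)) \<infinity>
        \<longleftrightarrow> x < entry \<rho> j"
      using entry_mem_set[of j \<rho>] entry_snoc_last[of \<rho> x] len set
      by (auto simp: entry_append1 cyc_interval_def)
  qed
  \<comment> \<open>Counting passes from positions to letters, as \<open>\<rho>\<close> contains
    each letter other than \<open>x\<close> exactly once.\<close>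
  also have "bij_betw (entry \<rho>) ?J {x<..Suc n}"
  proof (rule bij_betw_imageI)
    show "inj_on (entry \<rho>) ?J"
      using dist len by (auto simp: inj_on_def entry_def nth_eq_iff_index_eq)
    show "entry \<rho> ` ?J = {x<..Suc n}"
    proof (intro equalityI subsetI)
      fix y assume "y \<in> entry \<rho> ` ?J"
      thus "y \<in> {x<..Suc n}"
        using entry_mem_set[of _ \<rho>] len set by fastforce
    next
      fix y assume y: "y \<in> {x<..Suc n}"
      hence "y \<in> set \<rho>" using set by auto
      then obtain k where "k < n" "\<rho> ! k = y" using len by (auto simp: in_set_conv_nth)
      thus "y \<in> entry \<rho> ` ?J"
        using y by (intro image_eqI[of _ _ "Suc k"]) (auto simp: entry_def)
    qed
  qed
  hence "card ?J = Suc n - x"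
    by (simp add: bij_betw_same_card)
  finally show ?thesis .
qed

text \<open>At an earlier position the statistic compares only letters of \<open>\<rho>\<close>, and
  standardization keeps their relative order.\<close>

lemma inv_code_snoc:
  assumes "\<rho> \<in> permutations_of_set ({1..Suc n} - {x})" "x \<in> {1..Suc n}"
  shows "inv_code (\<rho> @ [x]) = inv_code (standardize x \<rho>) @ [Suc n - x]"
proof -
  have len: "length \<rho> = n" and set: "set \<rho> = {1..Suc n} - {x}"
    using assms length_permutations_of_interval_remove by (auto dest: permutations_of_setD)
  have "t_stat (\<rho> @ [x]) i = t_stat (standardize x \<rho>) i" if i: "i \<in> {1..n}" for i
    unfolding t_stat_def
  proof (intro arg_cong[where f = card] Collect_cong conj_cong refl)
    fix j assume "j \<in> {1..<i}"
    hence j: "j \<in> {1..length \<rho>}" and i: "i \<in> {1..length \<rho>}" using len i by auto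
    show "entry (\<rho> @ [x]) j \<in> cyc_interval (length (\<rho> @ [x])) (entry (\<rho> @ [x]) i) \<infinity> \<longleftrightarrow>
      entry (standardize x \<rho>) j \<in>
        cyc_interval (length (standardize x \<rho>)) (entry (standardize x \<rho>) i) \<infinity>"
      using mem_cyc_interval_standardize[of x n "entry \<rho> i" "entry \<rho> j"]
        assms(2) entry_mem_set[OF i] entry_mem_set[OF j] set len
      by (simp add: standardize_def entry_append1[OF i] entry_append1[OF j]
          entry_map[OF i] entry_map[OF j])
  qed
  hence "map (t_stat (\<rho> @ [x])) [1..<Suc n] = map (t_stat (standardize x \<rho>)) [1..<Suc n]"
    by (intro map_cong) auto
  thus ?thesis
    using t_stat_snoc_last[OF assms] len by (simp add: inv_code_def standardize_def)
qed

text \<open>The entry after the last is infinity by convention, so both statistics use the same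
  interval there.\<close>

lemma s_stat_length: "s_stat \<sigma> (length \<sigma>) = t_stat \<sigma> (length \<sigma>)"
  by (simp add: s_stat_def t_stat_def entry_inf_def)

lemma maj_code_snoc:
  assumes "\<rho> \<in> permutations_of_set ({1..Suc n} - {x})" "x \<in> {1..Suc n}"
  shows "maj_code (\<rho> @ [x]) = maj_code (cyc_shift (Suc n) x \<rho>) @ [Suc n - x]"
proof -
  let ?\<tau> = "cyc_shift (Suc n) x \<rho>"
  have len: "length \<rho> = n" and set: "set \<rho> = {1..Suc n} - {x}"
    using assms length_permutations_of_interval_remove by (auto dest: permutations_of_setD)
  have "s_stat (\<rho> @ [x]) i = s_stat ?\<tau> i" if i: "i \<in> {1..n}" for i
    unfolding s_stat_def
  proof (intro arg_cong[where f = card] Collect_cong conj_cong refl)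
    fix j assume "j \<in> {1..<i}"
    hence j: "j \<in> {1..length \<rho>}" and i: "i \<in> {1..length \<rho>}" using len i by auto
    note entries = entry_append1[OF i] entry_append1[OF j] entry_map[OF i] entry_map[OF j]
    show "entry (\<rho> @ [x]) j \<in>
        cyc_interval (length (\<rho> @ [x])) (entry (\<rho> @ [x]) i) (entry_inf (\<rho> @ [x]) (i + 1)) \<longleftrightarrow>
      entry ?\<tau> j \<in> cyc_interval (length ?\<tau>) (entry ?\<tau> i) (entry_inf ?\<tau> (i + 1))"
    \<comment> \<open>Only position \<open>n\<close> has \<open>x\<close> as the right end of its
      interval; in \<open>?\<tau>\<close> that end is infinity. At smaller positions both ends are
      letters of \<open>\<rho>\<close>.\<close>
    proof (cases "i = n")
      case True
      have "entry_inf (\<rho> @ [x]) (i + 1) = enat x" "entry_inf ?\<tau> (i + 1) = \<infinity>"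
        using True len entry_snoc_last[of \<rho> x] by (simp_all add: entry_inf_def cyc_shift_def)
      thus ?thesis
        using mem_cyc_interval_rotate_infinity[of x n "entry \<rho> i" "entry \<rho> j"]
          assms(2) entry_mem_set[OF i] entry_mem_set[OF j] set len
        by (simp add: cyc_shift_def entries)
    next
      case False
      hence k: "Suc i \<in> {1..length \<rho>}" using i len by auto
      thus ?thesis
        using mem_cyc_interval_rotate[of x n "entry \<rho> i" "entry \<rho> (Suc i)" "entry \<rho> j"]
          assms(2) entry_mem_set[OF i] entry_mem_set[OF j] entry_mem_set[OF k] set len
        by (simp add: cyc_shift_def entry_inf_def entries entry_append1[OF k] entry_map[OF k])
    qed
  qed
  hence "map (s_stat (\<rho> @ [x])) [1..<Suc n] = map (s_stat ?\<tau>) [1..<Suc n]"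
    by (intro map_cong) auto
  moreover have "s_stat (\<rho> @ [x]) (Suc n) = Suc n - x"
    using s_stat_length[of "\<rho> @ [x]"] t_stat_snoc_last[OF assms] len by simp
  ultimately show ?thesis
    using len by (simp add: maj_code_def cyc_shift_def)
qed

section \<open>Injectivity of the codes\<close>

text \<open>The last code entry reveals \<open>x\<close>; the others determine the reduced
  permutation by induction, and hence \<open>\<rho>\<close>. Keeping \<open>code\<close> and
  \<open>red\<close> abstract covers both codes at once.\<close>

lemma inj_on_code_perms:
  fixes code :: "nat list \<Rightarrow> nat list" and red :: "nat \<Rightarrow> nat \<Rightarrow> nat list \<Rightarrow> nat list"
  assumes bij: "\<And>n x. x \<in> {1..Suc n} \<Longrightarrow>
      bij_betw (red n x) (permutations_of_set ({1..Suc n} - {x})) (perms n)"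
    and code: "\<And>n x \<rho>. \<rho> \<in> permutations_of_set ({1..Suc n} - {x}) \<Longrightarrow> x \<in> {1..Suc n} \<Longrightarrow>
      code (\<rho> @ [x]) = code (red n x \<rho>) @ [Suc n - x]"
  shows "inj_on code (perms n)"
proof (induction n)
  case 0
  show ?case by simp
next
  case (Suc n)
  show ?case
  proof (rule inj_onI)
    fix \<sigma> \<sigma>' assume "\<sigma> \<in> perms (Suc n)" "\<sigma>' \<in> perms (Suc n)" and eq: "code \<sigma> = code \<sigma>'"
    then obtain x \<rho> x' \<rho>' where
        x: "x \<in> {1..Suc n}" "\<rho> \<in> permutations_of_set ({1..Suc n} - {x})" "\<sigma> = \<rho> @ [x]"
      and x': "x' \<in> {1..Suc n}" "\<rho>' \<in> permutations_of_set ({1..Suc n} - {x'})" "\<sigma>' = \<rho>' @ [x']"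
      unfolding perms_Suc_iff by blast
    have "code (red n x \<rho>) = code (red n x' \<rho>')" "Suc n - x = Suc n - x'"
      using eq code[OF x(2,1)] code[OF x'(2,1)] x(3) x'(3) by auto
    \<comment> \<open>Both letters are at most \<open>Suc n\<close>, so the truncated subtractions
      are exact.\<close>
    moreover from this(2) have xx: "x = x'" using x(1) x'(1) by auto
    moreover have "red n x \<rho> \<in> perms n" "red n x \<rho>' \<in> perms n"
      using bij_betwE[OF bij[OF x(1)]] x(2) x'(2) xx by auto
    ultimately have "red n x \<rho> = red n x \<rho>'"
      using Suc.IH by (auto dest: inj_onD)
    hence "\<rho> = \<rho>'"
      using bij_betw_imp_inj_on[OF bij[OF x(1)]] x(2) x'(2) xx by (auto dest: inj_onD)
    thus "\<sigma> = \<sigma>'" using x(3) x'(3) xx by simp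
  qed
qed

lemma inj_on_inv_code: "inj_on inv_code (perms n)"
  by (rule inj_on_code_perms[where red = "\<lambda>_. standardize"])
    (simp_all only: bij_betw_standardize inv_code_snoc)

lemma inj_on_maj_code: "inj_on maj_code (perms n)"
  by (rule inj_on_code_perms[where red = "\<lambda>n. cyc_shift (Suc n)"])
    (simp_all only: bij_betw_cyc_shift maj_code_snoc)

section \<open>Han's map intertwines the recursions\<close>

text \<open>This extends the recursion to one-letter words, where \<open>han\<close> is defined by
  its base case, so that inductions can start at the empty word.\<close>

lemma han_snoc:
  assumes "\<rho> \<in> permutations_of_set ({1..Suc n} - {x})" "x \<in> {1..Suc n}"
  shows "han (\<rho> @ [x]) = standardize_inv (Suc n) x (han (cyc_shift (Suc n) x \<rho>)) @ [x]"
proof (cases "n = 0")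
  case True
  with assms have [simp]: "\<rho> = []" "x = 1"
    using length_permutations_of_interval_remove[OF assms] by auto
  \<comment> \<open>The empty word is the only permutation of the empty set, so the inverse has to
    return it.\<close>
  have "inv_into {[]} (standardize 1) [] \<in> {[]}"
    by (rule inv_into_into) (simp add: standardize_def)
  thus ?thesis
    using True by (simp add: han.simps standardize_inv_def cyc_shift_def)
next
  case False
  thus ?thesis
    using length_permutations_of_interval_remove[OF assms] by (subst han.simps) auto
qed

text \<open>Membership is proved along with the code identity because \<open>standardize_inv\<close>
  inverts \<open>standardize\<close> only on permutations of the reduced alphabet.\<close>

lemma han_perms_and_maj_code:
  "\<sigma> \<in> perms n \<Longrightarrow> han \<sigma> \<in> perms n \<and> maj_code \<sigma> = inv_code (han \<sigma>)"
proof (induction n arbitrary: \<sigma>)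
  case 0
  thus ?case by (simp add: han.simps maj_code_def inv_code_def)
next
  case (Suc n)
  then obtain x \<rho> where
    x: "x \<in> {1..Suc n}" "\<rho> \<in> permutations_of_set ({1..Suc n} - {x})" "\<sigma> = \<rho> @ [x]"
    unfolding perms_Suc_iff by blast
  define \<tau> where "\<tau> = cyc_shift (Suc n) x \<rho>"
  define \<rho>' where "\<rho>' = standardize_inv (Suc n) x (han \<tau>)"
  have "\<tau> \<in> perms n"
    using bij_betwE[OF bij_betw_cyc_shift[OF x(1)]] x(2) by (auto simp: \<tau>_def)
  note IH = Suc.IH[OF this]
  have han: "han \<sigma> = \<rho>' @ [x]"
    using han_snoc[OF x(2,1)] x(3) by (simp add: \<rho>'_def \<tau>_def)
  \<comment> \<open>Surjectivity of \<open>standardize x\<close> makes the choice in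
    \<open>inv_into\<close> a true preimage.\<close>
  have "han \<tau> \<in> standardize x ` permutations_of_set ({1..Suc n} - {x})"
    using IH bij_betw_standardize[OF x(1)] by (simp add: bij_betw_def)
  hence \<rho>': "\<rho>' \<in> permutations_of_set ({1..Suc n} - {x})" "standardize x \<rho>' = han \<tau>"
    unfolding \<rho>'_def standardize_inv_def by (rule inv_into_into, rule f_inv_into_f)
  have "han \<sigma> \<in> perms (Suc n)"
    unfolding perms_Suc_iff using han x(1) \<rho>'(1) by blast
  \<comment> \<open>Both codes end in \<open>Suc n - x\<close>; their initial parts are
    \<open>maj_code \<tau>\<close> and \<open>inv_code (han \<tau>)\<close>, equal by
    induction.\<close>
  moreover have "maj_code \<sigma> = inv_code (han \<sigma>)"
    unfolding han unfolding x(3)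
    using maj_code_snoc[OF x(2,1)] inv_code_snoc[OF \<rho>'(1) x(1)] IH \<rho>'(2)
    by (simp add: \<tau>_def)
  ultimately show ?case by blast
qed

theorem theorem2p2:
  fixes n :: nat
  assumes "n \<ge> 1"
  shows "bij_betw han (perms n) (perms n) \<and>
         (\<forall>\<sigma> \<in> perms n. han \<sigma> = inv_into (perms n) inv_code (maj_code \<sigma>)) \<and>
         (\<forall>\<sigma> \<in> perms n. maj_code \<sigma> = inv_code (han \<sigma>))"
proof -
  have inj: "inj_on han (perms n)"
  proof (rule inj_onI)
    fix \<sigma> \<sigma>' assume "\<sigma> \<in> perms n" "\<sigma>' \<in> perms n" "han \<sigma> = han \<sigma>'"
    thus "\<sigma> = \<sigma>'"
      \<comment> \<open>Equal images have equal inversion codes, so the arguments have equal cyclic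
        major codes.\<close>
      using han_perms_and_maj_code inj_on_maj_code[of n] by (metis inj_onD)
  qed
  have "han ` perms n = perms n"
    using han_perms_and_maj_code by (intro endo_inj_surj inj) auto
  with inj have "bij_betw han (perms n) (perms n)"
    by (simp add: bij_betw_def)
  thus ?thesis
    \<comment> \<open>Injectivity of \<open>inv_code\<close> lets \<open>inv_into\<close> recover
      \<open>han \<sigma>\<close> from its code.\<close>
    using han_perms_and_maj_code inj_on_inv_code[of n] by simp
qed

end
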